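(* Let $n\ge 2$ and let $\mathcal H=\mathcal H_1\otimes\cdots\otimes\mathcal H_n$ be an $n$-partite quantum system with finite local dimensions $\dim\mathcal H_i\ge2$. Let $\mathcal G$ be the geometric mean of bipartite concurrences (GBC) on the states of $\mathcal H$. Then $\mathcal G(\rho)\le 1$ for every state $\rho$ on $\mathcal H$, and $\mathcal G(|\psi\rangle)=1$ for every absolutely maximally entangled state $|\psi\rangle\in\mathcal H$. That is, whenever absolutely maximally entangled states exist in $\mathcal H$, the GBC takes its maximal value $1$ on them.
   Context: States are density operators on $\mathcal H$; pure states are unit vectors $|\psi\rangle$, identified with $|\psi\rangle\langle\psi|$. Bipartitions. A bipartition $\{A|B\}$ is an unordered partition of the set of parties $\{1,\dots,n\}$ into two nonempty complementary subsets $A,B$. Let $\alpha$ be the set of all bipartitions and $c(\alpha)=2^{n-1}-1$ its cardinality. Regularized bipartite concurrence. For a pure state $|\psi\rangle$ and a bipartition $\{A|B\}$, $$\mathcal C_{AB}(|\psi\rangle)=\sqrt{\frac{d_{\min}}{d_{\min}-1}\bigl(1-\mathrm{tr}(\rho_A^2)\bigr)},\qquad \rho_A=\mathrm{tr}_B(|\psi\rangle\langle\psi|),$$ where $d_{\min}=\min(d_A,d_B)$, with $d_A=\prod_{i\in A}\dim\mathcal H_i$ and $d_B=\prod_{i\in B}\dim\mathcal H_i$. GBC. For a pure state, $$\mathcal G(|\psi\rangle)=\Bigl(\prod_{\{A|B\}\in\alpha}\mathcal C_{AB}(|\psi\rangle)\Bigr)^{1/c(\alpha)}.$$ For a mixed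 state, $\mathcal G(\rho)=\min\sum_i p_i\,\mathcal G(|\psi_i\rangle)$, the minimum being over all ensemble realizations $\rho=\sum_i p_i|\psi_i\rangle\langle\psi_i|$ with $p_i\ge0$, $\sum_i p_i=1$. Absolutely maximally entangled (AME) state. A pure state $|\psi\rangle\in\mathcal H$ is AME if, for every bipartition of the parties, the reduced density matrix of the smaller subsystem (the one of smaller dimension) is maximally mixed, i.e. equals the identity divided by $d_{\min}$. *)

theory Defs
  imports "HOL-Analysis.Analysis" "HOL-Library.Disjoint_Sets"
begin

text \<open>
  The parties are the elements of \<open>{1..n}\<close>, and party \<open>i\<close> has the Hilbert space of dimension \<open>d i\<close>
  with orthonormal basis labelled by \<open>{..<d i}\<close>.  For a set \<open>S\<close> of parties, the tensor product of
  the local spaces has the product basis labelled by the multi-indices in \<open>multi_index d S\<close>.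
  Vectors and operators are given by their coordinates in this basis; values at other labels
  are never looked at.
\<close>

type_synonym label = "nat \<Rightarrow> nat"
type_synonym ket = "label \<Rightarrow> complex"
type_synonym oper = "label \<Rightarrow> label \<Rightarrow> complex"

definition multi_index :: "(nat \<Rightarrow> nat) \<Rightarrow> nat set \<Rightarrow> label set" where
  "multi_index d S = (\<Pi>\<^sub>E i\<in>S. {..<d i})"

definition hdim :: "(nat \<Rightarrow> nat) \<Rightarrow> nat set \<Rightarrow> nat" where
  "hdim d S = (\<Prod>i\<in>S. d i)"

lemma card_multi_index: "finite S \<Longrightarrow> card (multi_index d S) = hdim d S"
  by (simp add: multi_index_def hdim_def card_PiE)

definition op_trace :: "(nat \<Rightarrow> nat) \<Rightarrow> nat set \<Rightarrow> oper \<Rightarrow> complex" where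
  "op_trace d S X = (\<Sum>x\<in>multi_index d S. X x x)"

definition op_mult :: "(nat \<Rightarrow> nat) \<Rightarrow> nat set \<Rightarrow> oper \<Rightarrow> oper \<Rightarrow> oper" where
  "op_mult d S X Y = (\<lambda>x z. \<Sum>y\<in>multi_index d S. X x y * Y y z)"

definition ketbra :: "ket \<Rightarrow> oper" where
  "ketbra \<psi> = (\<lambda>x y. \<psi> x * cnj (\<psi> y))"

text \<open>The trace over the parties in \<open>B\<close> of an operator on the parties \<open>A \<union> B\<close>.\<close>

definition partial_trace :: "(nat \<Rightarrow> nat) \<Rightarrow> nat set \<Rightarrow> nat set \<Rightarrow> oper \<Rightarrow> oper" where
  "partial_trace d A B X =
     (\<lambda>a a'. \<Sum>b\<in>multi_index d B. X (merge A B (a, b)) (merge A B (a', b)))"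

definition pure_state :: "nat \<Rightarrow> (nat \<Rightarrow> nat) \<Rightarrow> ket \<Rightarrow> bool" where
  "pure_state n d \<psi> \<longleftrightarrow> (\<Sum>x\<in>multi_index d {1..n}. (cmod (\<psi> x))\<^sup>2) = 1"

definition density_operator :: "nat \<Rightarrow> (nat \<Rightarrow> nat) \<Rightarrow> oper \<Rightarrow> bool" where
  "density_operator n d \<rho> \<longleftrightarrow>
     (\<forall>x\<in>multi_index d {1..n}. \<forall>y\<in>multi_index d {1..n}. \<rho> y x = cnj (\<rho> x y)) \<and>
     (\<forall>v :: ket. 0 \<le> Re (\<Sum>x\<in>multi_index d {1..n}. \<Sum>y\<in>multi_index d {1..n}.
                          cnj (v x) * \<rho> x y * v y)) \<and>
     op_trace d {1..n} \<rho> = 1"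

text \<open>An unordered bipartition of the parties is a set \<open>{A, B}\<close> of two blocks.\<close>

definition bipartitions :: "nat \<Rightarrow> nat set set set" where
  "bipartitions n = {P. partition_on {1..n} P \<and> card P = 2}"

lemma doubleton_in_bipartitions_iff:
  "{A, B} \<in> bipartitions n \<longleftrightarrow> A \<noteq> {} \<and> B \<noteq> {} \<and> A \<inter> B = {} \<and> A \<union> B = {1..n}"
proof
  assume "{A, B} \<in> bipartitions n"
  then have p: "partition_on {1..n} {A, B}" and c: "card {A, B} = 2"
    by (auto simp: bipartitions_def)
  from c have "A \<noteq> B" by auto
  with p show "A \<noteq> {} \<and> B \<noteq> {} \<and> A \<inter> B = {} \<and> A \<union> B = {1..n}"
    by (auto simp: partition_on_def disjoint_def)
next
  assume h: "A \<noteq> {} \<and> B \<noteq> {} \<and> A \<inter> B = {} \<and> A \<union> B = {1..n}"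
  then have "A \<noteq> B" by auto
  with h show "{A, B} \<in> bipartitions n"
    by (auto simp: bipartitions_def partition_on_def disjoint_def)
qed

lemma bipartitionsE:
  assumes "P \<in> bipartitions n"
  obtains A B where "P = {A, B}" "{A, B} \<in> bipartitions n"
  using assms unfolding bipartitions_def by (auto simp: card_2_iff)

lemma bipartitions_eq_image:
  assumes "n \<ge> 1"
  shows "bipartitions n = (\<lambda>S. {S, {1..n} - S}) ` (Pow {2..n} - {{}})"
proof (intro equalityI subsetI)
  fix P assume P: "P \<in> bipartitions n"
  then obtain A B where AB: "P = {A, B}" "{A, B} \<in> bipartitions n"
    by (rule bipartitionsE)
  then have h: "A \<noteq> {}" "B \<noteq> {}" "A \<inter> B = {}" "A \<union> B = {1..n}"
    by (auto simp: doubleton_in_bipartitions_iff)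
  have one: "1 \<in> A \<union> B" using assms h by simp
  have *: "S \<subseteq> {2..n}" if "S \<subseteq> {1..n}" "1 \<notin> S" for S
  proof
    fix x assume "x \<in> S"
    then have "x \<in> {1..n}" "x \<noteq> 1" using that by auto
    then show "x \<in> {2..n}" by auto
  qed
  show "P \<in> (\<lambda>S. {S, {1..n} - S}) ` (Pow {2..n} - {{}})"
  proof (cases "1 \<in> A")
    case True
    then have "B \<subseteq> {2..n}" using h by (intro *) auto
    moreover have "{1..n} - B = A" using h by auto
    ultimately show ?thesis using h AB
      by (intro image_eqI[where x = B]) (simp_all add: insert_commute)
  next
    case False
    then have "A \<subseteq> {2..n}" using h by (intro *) auto
    moreover have "{1..n} - A = B" using h by auto
    ultimately show ?thesis using h AB
      by (intro image_eqI[where x = A]) simp_all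
  qed
next
  fix P assume "P \<in> (\<lambda>S. {S, {1..n} - S}) ` (Pow {2..n} - {{}})"
  then obtain S where S: "P = {S, {1..n} - S}" "S \<subseteq> {2..n}" "S \<noteq> {}" by auto
  have "1 \<in> {1..n} - S" using S(2) assms by auto
  then have "{1..n} - S \<noteq> {}" by blast
  moreover have "S \<subseteq> {1..n}" using S(2) by auto
  then have "S \<union> ({1..n} - S) = {1..n}" by (rule Diff_partition)
  ultimately show "P \<in> bipartitions n"
    unfolding S(1) doubleton_in_bipartitions_iff using S(3) by (simp only: Diff_disjoint) simp
qed

lemma card_bipartitions:
  assumes "n \<ge> 1"
  shows "card (bipartitions n) = 2 ^ (n - 1) - 1"
proof -
  have "inj_on (\<lambda>S. {S, {1..n} - S}) (Pow {2..n} - {{}})"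
  proof (rule inj_onI)
    fix S T assume S: "S \<in> Pow {2..n} - {{}}" and T: "T \<in> Pow {2..n} - {{}}"
      and eq: "{S, {1..n} - S} = {T, {1..n} - T}"
    have "1 \<in> {1..n} - S" "1 \<notin> T" using S T assms by auto
    then have "{1..n} - S \<noteq> T" by blast
    with eq show "S = T" by (metis doubleton_eq_iff)
  qed
  then have "card (bipartitions n) = card (Pow {2..n} - {{}})"
    unfolding bipartitions_eq_image[OF assms] by (rule card_image)
  also have "\<dots> = 2 ^ (n - 1) - 1"
    by (subst card_Diff_subset) (auto simp: card_Pow)
  finally show ?thesis .
qed

definition reduced_state :: "(nat \<Rightarrow> nat) \<Rightarrow> nat set \<Rightarrow> nat set \<Rightarrow> ket \<Rightarrow> oper" where
  "reduced_state d A B \<psi> = partial_trace d A B (ketbra \<psi>)"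

definition concurrence_AB :: "(nat \<Rightarrow> nat) \<Rightarrow> nat set \<Rightarrow> nat set \<Rightarrow> ket \<Rightarrow> real" where
  "concurrence_AB d A B \<psi> =
     (let dmin = real (min (hdim d A) (hdim d B));
          \<rho>\<^sub>A = reduced_state d A B \<psi>
      in sqrt (dmin / (dmin - 1) * (1 - Re (op_trace d A (op_mult d A \<rho>\<^sub>A \<rho>\<^sub>A)))))"

lemma merge_commute: "A \<inter> B = {} \<Longrightarrow> merge A B (a, b) = merge B A (b, a)"
  by (auto simp: merge_def fun_eq_iff)

lemma purity_commute:
  assumes "A \<inter> B = {}"
  shows "op_trace d A (op_mult d A (reduced_state d A B \<psi>) (reduced_state d A B \<psi>)) =
         op_trace d B (op_mult d B (reduced_state d B A \<psi>) (reduced_state d B A \<psi>))"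
proof -
  let ?A = "multi_index d A" and ?B = "multi_index d B"
  define f where "f = (\<lambda>a b. \<psi> (merge A B (a, b)))"
  have f': "\<psi> (merge B A (b, a)) = f a b" for a b
    unfolding f_def merge_commute[OF assms] ..
  let ?g = "\<lambda>a a' b b'. f a b * cnj (f a' b) * (f a' b' * cnj (f a b'))"
  have "op_trace d A (op_mult d A (reduced_state d A B \<psi>) (reduced_state d A B \<psi>)) =
        (\<Sum>a\<in>?A. \<Sum>a'\<in>?A. \<Sum>b\<in>?B. \<Sum>b'\<in>?B. ?g a a' b b')"
    unfolding op_trace_def op_mult_def reduced_state_def partial_trace_def ketbra_def
      sum_product f_def ..
  also have "\<dots> = (\<Sum>a\<in>?A. \<Sum>b\<in>?B. \<Sum>a'\<in>?A. \<Sum>b'\<in>?B. ?g a a' b b')"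
    by (intro sum.cong refl sum.swap)
  also have "\<dots> = (\<Sum>b\<in>?B. \<Sum>a\<in>?A. \<Sum>a'\<in>?A. \<Sum>b'\<in>?B. ?g a a' b b')"
    by (rule sum.swap)
  also have "\<dots> = (\<Sum>b\<in>?B. \<Sum>a\<in>?A. \<Sum>b'\<in>?B. \<Sum>a'\<in>?A. ?g a a' b b')"
    by (intro sum.cong refl sum.swap)
  also have "\<dots> = (\<Sum>b\<in>?B. \<Sum>b'\<in>?B. \<Sum>a\<in>?A. \<Sum>a'\<in>?A. ?g a a' b b')"
    by (intro sum.cong refl sum.swap)
  also have "\<dots> = op_trace d B (op_mult d B (reduced_state d B A \<psi>) (reduced_state d B A \<psi>))"
    unfolding op_trace_def op_mult_def reduced_state_def partial_trace_def ketbra_def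
      sum_product f' by (intro sum.cong refl) (simp only: mult_ac)
  finally show ?thesis .
qed

lemma concurrence_AB_commute:
  "A \<inter> B = {} \<Longrightarrow> concurrence_AB d A B \<psi> = concurrence_AB d B A \<psi>"
  by (simp add: concurrence_AB_def Let_def purity_commute[of A B] min.commute)

text \<open>
  By \<open>concurrence_AB_commute\<close> the value does not depend on which block of the bipartition
  is picked as \<open>A\<close>; see \<open>concurrence_doubleton\<close>.
\<close>

definition concurrence :: "nat \<Rightarrow> (nat \<Rightarrow> nat) \<Rightarrow> nat set set \<Rightarrow> ket \<Rightarrow> real" where
  "concurrence n d P \<psi> = (let A = (SOME A. A \<in> P) in concurrence_AB d A ({1..n} - A) \<psi>)"

lemma concurrence_doubleton:
  assumes "{A, B} \<in> bipartitions n"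
  shows "concurrence n d {A, B} \<psi> = concurrence_AB d A B \<psi>"
proof -
  have h: "A \<inter> B = {}" "A \<union> B = {1..n}"
    using assms by (auto simp: doubleton_in_bipartitions_iff)
  then have "{1..n} - A = B" "{1..n} - B = A" by auto
  moreover have "(SOME C. C \<in> {A, B}) \<in> {A, B}" by (rule someI[of _ A]) simp
  ultimately show ?thesis
    using concurrence_AB_commute[OF h(1)] by (auto simp: concurrence_def Let_def)
qed

definition gbc_pure :: "nat \<Rightarrow> (nat \<Rightarrow> nat) \<Rightarrow> ket \<Rightarrow> real" where
  "gbc_pure n d \<psi> =
     (\<Prod>P\<in>bipartitions n. concurrence n d P \<psi>) powr (1 / real (card (bipartitions n)))"

definition ensemble_of ::
    "nat \<Rightarrow> (nat \<Rightarrow> nat) \<Rightarrow> oper \<Rightarrow> nat \<Rightarrow> (nat \<Rightarrow> real) \<Rightarrow> (nat \<Rightarrow> ket) \<Rightarrow> bool" where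
  "ensemble_of n d \<rho> m p \<Psi> \<longleftrightarrow>
     (\<forall>i<m. 0 \<le> p i \<and> pure_state n d (\<Psi> i)) \<and> (\<Sum>i<m. p i) = 1 \<and>
     (\<forall>x\<in>multi_index d {1..n}. \<forall>y\<in>multi_index d {1..n}.
        \<rho> x y = (\<Sum>i<m. complex_of_real (p i) * ketbra (\<Psi> i) x y))"

text \<open>
  The convex roof.  The set of ensemble averages is bounded below by 0, and it is nonempty for a
  density operator by the spectral theorem.  Its infimum is its minimum, which is attained by
  compactness.
\<close>

definition gbc :: "nat \<Rightarrow> (nat \<Rightarrow> nat) \<Rightarrow> oper \<Rightarrow> real" where
  "gbc n d \<rho> = Inf {(\<Sum>i<m. p i * gbc_pure n d (\<Psi> i)) | m p \<Psi>. ensemble_of n d \<rho> m p \<Psi>}"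

text \<open>
  Bipartitions are enumerated with \<open>A\<close> as the smaller subsystem, so that its dimension is the
  minimal one.  When the two dimensions agree, both reduced states are required to be maximally
  mixed.
\<close>

definition ame_state :: "nat \<Rightarrow> (nat \<Rightarrow> nat) \<Rightarrow> ket \<Rightarrow> bool" where
  "ame_state n d \<psi> \<longleftrightarrow> pure_state n d \<psi> \<and>
     (\<forall>A B. {A, B} \<in> bipartitions n \<longrightarrow> hdim d A \<le> hdim d B \<longrightarrow>
        (\<forall>x\<in>multi_index d A. \<forall>y\<in>multi_index d A.
           reduced_state d A B \<psi> x y = (if x = y then 1 / of_nat (hdim d A) else 0)))"

end

(* Everything reduces to the purity bounds 1/d_min <= tr (rho_A^2) <= 1 for a unit vector:
   the upper one is Cauchy-Schwarz for the entries of rho_A, the lower one compares tr (rho_A^2)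
   with its diagonal part and uses that both reductions have the same purity.  An AME state attains
   the lower bound on every bipartition.  A density operator has an ensemble by repeatedly
   splitting off a rank-one term and passing to the Schur complement, so the convex roof is an
   infimum over a nonempty set of averages of numbers in [0, 1].  For a projector onto psi
   every ensemble member of positive weight is psi up to a phase. *)
theory Submission
  imports Defs
begin

section \<open>Rank-one decomposition of positive semidefinite matrices\<close>

text \<open>These are the first two clauses of \<open>density_operator\<close> over an arbitrary
  index set, so that indices can be removed one at a time. The trace condition is left out because a
  Schur complement does not inherit it.\<close>

definition psd_on :: "'a set \<Rightarrow> ('a \<Rightarrow> 'a \<Rightarrow> complex) \<Rightarrow> bool" where
  "psd_on X \<rho> \<longleftrightarrow> (\<forall>x\<in>X. \<forall>y\<in>X. \<rho> y x = cnj (\<rho> x y)) \<and>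
     (\<forall>v. 0 \<le> Re (\<Sum>x\<in>X. \<Sum>y\<in>X. cnj (v x) * \<rho> x y * v y))"

text \<open>The form is evaluated at \<open>v\<close> extended by the value \<open>t\<close> at
  \<open>z\<close>; the two cross terms are conjugate. Each later use is a choice of
  \<open>t\<close>.\<close>

lemma psd_on_insert_form:
  assumes psd: "psd_on (insert z X) \<rho>" and X: "finite X" "z \<notin> X"
  shows "0 \<le> Re (\<Sum>x\<in>X. \<Sum>y\<in>X. cnj (v x) * \<rho> x y * v y)
               + 2 * Re (cnj t * (\<Sum>y\<in>X. \<rho> z y * v y)) + (cmod t)\<^sup>2 * Re (\<rho> z z)"
proof -
  define w where "w = v(z := t)"
  define s where "s = (\<Sum>y\<in>X. \<rho> z y * v y)"
  have w: "w x = v x" if "x \<in> X" for x using that X by (auto simp: w_def)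
  have wz: "w z = t" by (simp add: w_def)
  have herm: "\<rho> x z = cnj (\<rho> z x)" if "x \<in> X" for x
    using psd that unfolding psd_on_def by blast
  have col: "(\<Sum>x\<in>X. cnj (v x) * \<rho> x z * t) = cnj (cnj t * s)"
    by (simp add: s_def herm sum_distrib_left mult_ac)
  have row: "(\<Sum>y\<in>X. cnj t * \<rho> z y * v y) = cnj t * s"
    by (simp add: s_def sum_distrib_left mult_ac)
  have diag: "Re (cnj t * \<rho> z z * t) = (cmod t)\<^sup>2 * Re (\<rho> z z)"
    unfolding cmod_power2 by (simp add: algebra_simps power2_eq_square)
  have "(\<Sum>x\<in>insert z X. \<Sum>y\<in>insert z X. cnj (w x) * \<rho> x y * w y)
      = cnj t * \<rho> z z * t + cnj t * s
        + (cnj (cnj t * s) + (\<Sum>x\<in>X. \<Sum>y\<in>X. cnj (v x) * \<rho> x y * v y))"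
    using X by (simp add: wz w sum.distrib col row)
  moreover have "0 \<le> Re (\<Sum>x\<in>insert z X. \<Sum>y\<in>insert z X. cnj (w x) * \<rho> x y * w y)"
    using psd unfolding psd_on_def by blast
  ultimately have "0 \<le> Re (cnj t * \<rho> z z * t) + Re (cnj t * s)
      + (Re (cnj (cnj t * s)) + Re (\<Sum>x\<in>X. \<Sum>y\<in>X. cnj (v x) * \<rho> x y * v y))"
    by (simp only: plus_complex.sel)
  then show ?thesis
    unfolding s_def[symmetric] diag cnj.sel by linarith
qed

text \<open>Without the quadratic term the form is affine in \<open>t\<close>, so a nonzero entry
  \<open>\<rho> z x\<close> would make it negative for a suitable \<open>t\<close>.\<close>

lemma psd_on_zero_diagonal:
  assumes psd: "psd_on (insert z X) \<rho>" and X: "finite X" "z \<notin> X"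
    and zero: "\<rho> z z = 0" and x: "x \<in> X"
  shows "\<rho> z x = 0"
proof (rule ccontr)
  assume "\<rho> z x \<noteq> 0"
  define v :: "'a \<Rightarrow> complex" where "v = (\<lambda>y. if y = x then 1 else 0)"
  define q where "q = Re (\<Sum>x\<in>X. \<Sum>y\<in>X. cnj (v x) * \<rho> x y * v y)"
  define c where "c = (cmod (\<rho> z x))\<^sup>2"
  have c: "c > 0" using \<open>\<rho> z x \<noteq> 0\<close> by (simp add: c_def)
  have s: "(\<Sum>y\<in>X. \<rho> z y * v y) = \<rho> z x"
    using X x by (simp add: v_def if_distrib cong: if_cong)
  \<comment> \<open>This \<open>k\<close> makes the linear term equal to
    \<open>- 2 * (\<bar>q\<bar> + 1)\<close>, which outweighs \<open>q\<close>.\<close>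
  define k where "k = (\<bar>q\<bar> + 1) / c"
  have "0 \<le> q + 2 * Re (cnj (- (of_real k * \<rho> z x)) * \<rho> z x)"
    using psd_on_insert_form[OF psd X, of v "- (of_real k * \<rho> z x)"]
    by (simp only: zero s q_def) simp
  also have "Re (cnj (- (of_real k * \<rho> z x)) * \<rho> z x) = - (k * c)"
    unfolding c_def cmod_power2 by (simp add: algebra_simps power2_eq_square)
  also have "k * c = \<bar>q\<bar> + 1" using c by (simp add: k_def)
  finally show False using abs_ge_self[of q] by simp
qed

lemma psd_on_diagonal:
  assumes "psd_on X \<rho>" "finite X" "z \<in> X"
  shows "\<rho> z z = complex_of_real (Re (\<rho> z z))" "0 \<le> Re (\<rho> z z)"
proof -
  have "\<rho> z z = cnj (\<rho> z z)" using assms unfolding psd_on_def by blast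
  then have "Im (\<rho> z z) = - Im (\<rho> z z)" by (simp add: complex_eq_iff)
  then show "\<rho> z z = complex_of_real (Re (\<rho> z z))"
    by (simp add: complex_eq_iff)
  have "psd_on (insert z (X - {z})) \<rho>" using assms by (simp add: insert_absorb)
  from psd_on_insert_form[OF this, of "\<lambda>_. 0" 1] assms show "0 \<le> Re (\<rho> z z)"
    by simp
qed

text \<open>When \<open>\<rho> z z = 0\<close> the subtracted term is \<open>0\<close>, since division by zero yields zero.\<close>

lemma psd_on_schur_complement:
  assumes psd: "psd_on (insert z X) \<rho>" and X: "finite X" "z \<notin> X"
  shows "psd_on X (\<lambda>x y. \<rho> x y - \<rho> x z * \<rho> z y / \<rho> z z)"
  unfolding psd_on_def
proof (intro conjI ballI allI)
  define r where "r = Re (\<rho> z z)"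
  have r: "\<rho> z z = of_real r" "r \<ge> 0"
    using psd_on_diagonal[OF psd, of z] X by (auto simp: r_def)
  have herm: "\<rho> y x = cnj (\<rho> x y)" if "x \<in> insert z X" "y \<in> insert z X" for x y
    using psd that unfolding psd_on_def by blast
  show "\<rho> y x - \<rho> y z * \<rho> z x / \<rho> z z = cnj (\<rho> x y - \<rho> x z * \<rho> z y / \<rho> z z)"
    if "x \<in> X" "y \<in> X" for x y
    using herm[of x y] herm[of x z] herm[of z y] that by (simp add: r)
  fix v
  define q where "q = (\<Sum>x\<in>X. \<Sum>y\<in>X. cnj (v x) * \<rho> x y * v y)"
  define s where "s = (\<Sum>y\<in>X. \<rho> z y * v y)"
  have cnj_s: "cnj s = (\<Sum>x\<in>X. cnj (v x) * \<rho> x z)"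
    using herm[of z] by (auto simp: s_def mult_ac intro!: sum.cong)
  have "(\<Sum>x\<in>X. \<Sum>y\<in>X. cnj (v x) * (\<rho> x y - \<rho> x z * \<rho> z y / \<rho> z z) * v y)
      = q - (\<Sum>x\<in>X. \<Sum>y\<in>X. (cnj (v x) * \<rho> x z) * (\<rho> z y * v y)) / \<rho> z z"
    unfolding q_def sum_divide_distrib sum_subtractf[symmetric]
    by (intro sum.cong refl) (simp add: algebra_simps diff_divide_distrib)
  also have "(\<Sum>x\<in>X. \<Sum>y\<in>X. (cnj (v x) * \<rho> x z) * (\<rho> z y * v y)) = cnj s * s"
    unfolding cnj_s by (simp only: s_def sum_product)
  also have "cnj s * s = of_real ((cmod s)\<^sup>2)"
    by (simp only: complex_norm_square mult.commute)
  also have "Re (q - of_real ((cmod s)\<^sup>2) / \<rho> z z) = Re q - (cmod s)\<^sup>2 / r"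
    unfolding r(1) by (simp flip: of_real_divide)
  also have "0 \<le> \<dots>"
  proof (cases "r = 0")
    case True
    \<comment> \<open>Here the quotient by \<open>r\<close> is 0 and only \<open>Re q\<close>
      remains, the form at \<open>t = 0\<close>.\<close>
    then show ?thesis using psd_on_insert_form[OF psd X, of v 0] by (simp add: q_def)
  next
    case False
    \<comment> \<open>Completing the square: \<open>t = - s / r\<close> minimises the form over
      \<open>t\<close>, and the minimum is the form of the Schur complement.\<close>
    have "Re (cnj (- s / of_real r) * s) = - ((cmod s)\<^sup>2 / r)"
      unfolding cmod_power2 by (simp add: power2_eq_square add_divide_distrib)
    moreover have "(cmod (- s / of_real r))\<^sup>2 * r = (cmod s)\<^sup>2 / r"
      using False by (simp add: norm_divide power_divide power2_eq_square)
    ultimately show ?thesis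
      using psd_on_insert_form[OF psd X, of v "- s / of_real r"]
      by (simp only: q_def s_def r_def)
  qed
  finally show "0 \<le> Re (\<Sum>x\<in>X. \<Sum>y\<in>X. cnj (v x) * (\<rho> x y - \<rho> x z * \<rho> z y / \<rho> z z) * v y)" .
qed

text \<open>Induction on the index set: the Schur complement at \<open>z\<close> is decomposed on
  \<open>X\<close>, and the column of \<open>z\<close>, scaled by the root of
  \<open>\<rho> z z\<close>, gives one more term. The vectors need not be orthogonal, so no
  diagonalisation is involved.\<close>

lemma psd_on_rank_one_decomposition:
  assumes "finite X" "psd_on X \<rho>"
  obtains m :: nat and v :: "nat \<Rightarrow> 'a \<Rightarrow> complex"
  where "\<And>x y. x \<in> X \<Longrightarrow> y \<in> X \<Longrightarrow> \<rho> x y = (\<Sum>i<m. v i x * cnj (v i y))"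
  using assms
proof (induction X arbitrary: \<rho> thesis rule: finite_induct)
  case empty
  then show ?case by blast
next
  case (insert z X)
  note psd = insert.prems(2)
  obtain m :: nat and v where mv: "\<And>x y. x \<in> X \<Longrightarrow> y \<in> X \<Longrightarrow>
      \<rho> x y - \<rho> x z * \<rho> z y / \<rho> z z = (\<Sum>i<m. v i x * cnj (v i y))"
    using insert.IH[OF _ psd_on_schur_complement[OF psd insert.hyps]] by blast
  define r where "r = Re (\<rho> z z)"
  have r: "\<rho> z z = of_real r" "r \<ge> 0"
    using psd_on_diagonal[OF psd, of z] insert.hyps by (auto simp: r_def)
  have herm: "\<rho> y x = cnj (\<rho> x y)" if "x \<in> insert z X" "y \<in> insert z X" for x y
    using psd that unfolding psd_on_def by blast
  have zero: "\<rho> z x = 0" if "x \<in> X" "r = 0" for x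
    using psd_on_zero_diagonal[OF psd insert.hyps _ that(1)] that(2) r(1) by simp
  \<comment> \<open>The vectors from the induction are extended by 0 at \<open>z\<close>, and the
    new one has index \<open>m\<close>. If \<open>r = 0\<close>, the division makes it the zero
    vector.\<close>
  define w where "w = (\<lambda>i x. if i = m then \<rho> x z / of_real (sqrt r)
                             else if x = z then 0 else v i x)"
  have sqrt_r: "complex_of_real (sqrt r) * of_real (sqrt r) = of_real r"
    using r(2) by (simp flip: of_real_mult)
  have last: "w m x * cnj (w m y) = \<rho> x z * \<rho> z y / \<rho> z z" if "y \<in> insert z X" for x y
    using herm[of z y] herm[of y z] that by (simp add: w_def sqrt_r r(1))
  have "\<rho> x y = (\<Sum>i<Suc m. w i x * cnj (w i y))"
    if x: "x \<in> insert z X" and y: "y \<in> insert z X" for x y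
  proof (cases "x = z \<or> y = z")
    case True
    \<comment> \<open>The row and the column of \<open>z\<close> come from the last term alone. If
      \<open>r = 0\<close>, they vanish by \<open>zero\<close>.\<close>
    have "(\<Sum>i<m. w i x * cnj (w i y)) = 0"
      using True by (intro sum.neutral) (auto simp: w_def)
    moreover have "\<rho> x z * \<rho> z y / \<rho> z z = \<rho> x y"
    proof (cases "r = 0")
      case True
      have "\<rho> z u = 0" "\<rho> u z = 0" if "u \<in> insert z X" for u
        using zero[OF _ True] herm[of z u] that r(1) True by auto
      with \<open>x = z \<or> y = z\<close> x y show ?thesis by auto
    next
      case False
      then show ?thesis using \<open>x = z \<or> y = z\<close> r(1) by auto
    qed
    ultimately show ?thesis using last[OF y] by simp
  next
    case False
    then have "(\<Sum>i<m. w i x * cnj (w i y)) = (\<Sum>i<m. v i x * cnj (v i y))"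
      by (intro sum.cong) (auto simp: w_def)
    also have "\<dots> = \<rho> x y - \<rho> x z * \<rho> z y / \<rho> z z"
      using mv[of x y] x y False by auto
    finally show ?thesis using last[OF y, of x] by simp
  qed
  then show ?case by (rule insert.prems(1))
qed

section \<open>Purity of reduced states\<close>

lemma finite_multi_index: "finite S \<Longrightarrow> finite (multi_index d S)"
  by (simp add: multi_index_def finite_PiE)

lemma merge_in_multi_index:
  assumes "A \<inter> B = {}" "a \<in> multi_index d A" "b \<in> multi_index d B"
  shows "merge A B (a, b) \<in> multi_index d (A \<union> B)"
  using assms by (auto simp: multi_index_def merge_def PiE_iff extensional_def)

text \<open>A label of the joint system is a pair of labels of the blocks: \<open>merge A B\<close>
  is inverted by the two restrictions, since extensionality fixes all values outside a
  block.\<close>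

lemma sum_merge:
  assumes "A \<inter> B = {}"
  shows "(\<Sum>a\<in>multi_index d A. \<Sum>b\<in>multi_index d B. f (merge A B (a, b)))
         = (\<Sum>x\<in>multi_index d (A \<union> B). f x)"
  unfolding sum.cartesian_product
proof (rule sum.reindex_bij_witness[where j = "merge A B"
      and i = "\<lambda>x. (restrict x A, restrict x B)"])
  fix p assume p: "p \<in> multi_index d A \<times> multi_index d B"
  then show "(restrict (merge A B p) A, restrict (merge A B p) B) = p"
    using assms by (auto simp: multi_index_def merge_def PiE_iff extensional_def fun_eq_iff)
  show "merge A B p \<in> multi_index d (A \<union> B)"
    using p merge_in_multi_index[OF assms] by (cases p) auto
  show "f (merge A B p) = (case p of (a, b) \<Rightarrow> f (merge A B (a, b)))"
    by (cases p) simp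
next
  fix x assume x: "x \<in> multi_index d (A \<union> B)"
  then show "merge A B (restrict x A, restrict x B) = x"
    by (auto simp: multi_index_def merge_def PiE_iff extensional_def fun_eq_iff)
  show "(restrict x A, restrict x B) \<in> multi_index d A \<times> multi_index d B"
    using x by (auto simp: multi_index_def PiE_iff)
qed

text \<open>Complex Cauchy-Schwarz, from the triangle inequality and the real case. It bounds both
  the entries of a reduced state and the overlap of two unit vectors.\<close>

lemma cmod_sum_mult_cnj_le:
  "(cmod (\<Sum>b\<in>B. f b * cnj (g b)))\<^sup>2 \<le> (\<Sum>b\<in>B. (cmod (f b))\<^sup>2) * (\<Sum>b\<in>B. (cmod (g b))\<^sup>2)"
proof -
  have "cmod (\<Sum>b\<in>B. f b * cnj (g b)) \<le> (\<Sum>b\<in>B. cmod (f b) * cmod (g b))"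
    by (rule order_trans[OF norm_sum]) (simp add: norm_mult)
  then have "(cmod (\<Sum>b\<in>B. f b * cnj (g b)))\<^sup>2 \<le> (\<Sum>b\<in>B. cmod (f b) * cmod (g b))\<^sup>2"
    by (rule power_mono) simp
  also have "\<dots> \<le> (\<Sum>b\<in>B. (cmod (f b))\<^sup>2) * (\<Sum>b\<in>B. (cmod (g b))\<^sup>2)"
    by (rule Cauchy_Schwarz_ineq_sum)
  finally show ?thesis .
qed

definition purity :: "(nat \<Rightarrow> nat) \<Rightarrow> nat set \<Rightarrow> nat set \<Rightarrow> ket \<Rightarrow> real" where
  "purity d A B \<psi> =
     Re (op_trace d A (op_mult d A (reduced_state d A B \<psi>) (reduced_state d A B \<psi>)))"

text \<open>A reduced state is Hermitian, so the products of opposite entries are squared moduli and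
  the purity is the squared Hilbert-Schmidt norm.\<close>

lemma purity_eq_sum:
  "purity d A B \<psi> =
     (\<Sum>a\<in>multi_index d A. \<Sum>a'\<in>multi_index d A. (cmod (reduced_state d A B \<psi> a a'))\<^sup>2)"
proof -
  have herm: "reduced_state d A B \<psi> a' a = cnj (reduced_state d A B \<psi> a a')" for a a'
    by (simp add: reduced_state_def partial_trace_def ketbra_def mult.commute)
  have "reduced_state d A B \<psi> a a' * reduced_state d A B \<psi> a' a
      = of_real ((cmod (reduced_state d A B \<psi> a a'))\<^sup>2)" for a a'
    unfolding herm[of a' a] by (simp only: complex_norm_square)
  then show ?thesis by (simp add: purity_def op_trace_def op_mult_def)
qed

text \<open>With \<open>N\<close> the diagonal of the reduced state, Cauchy-Schwarz bounds the
  squared modulus of the entry at \<open>a\<close>, \<open>a'\<close> by \<open>N a * N a'\<close>.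
  The double sum is then at most the square of the trace.\<close>

lemma purity_le_1:
  assumes "A \<inter> B = {}" "(\<Sum>x\<in>multi_index d (A \<union> B). (cmod (\<psi> x))\<^sup>2) = 1"
  shows "purity d A B \<psi> \<le> 1"
proof -
  define N where "N = (\<lambda>a. \<Sum>b\<in>multi_index d B. (cmod (\<psi> (merge A B (a, b))))\<^sup>2)"
  have "purity d A B \<psi> \<le> (\<Sum>a\<in>multi_index d A. \<Sum>a'\<in>multi_index d A. N a * N a')"
    unfolding purity_eq_sum
    by (intro sum_mono) (simp add: reduced_state_def partial_trace_def ketbra_def N_def
        cmod_sum_mult_cnj_le)
  also have "\<dots> = (\<Sum>a\<in>multi_index d A. N a)\<^sup>2"
    by (simp only: power2_eq_square sum_product)
  also have "(\<Sum>a\<in>multi_index d A. N a) = 1"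
    using sum_merge[OF assms(1), where f = "\<lambda>x. (cmod (\<psi> x))\<^sup>2"] assms(2)
    by (simp add: N_def)
  finally show ?thesis by simp
qed

text \<open>The diagonal \<open>N\<close> has sum 1 over \<open>hdim d A\<close> labels.
  Cauchy-Schwarz against the constant 1 bounds the sum of its squares from below, and the
  off-diagonal entries only add to the purity.\<close>

lemma purity_ge:
  assumes fin: "finite A" and disj: "A \<inter> B = {}"
    and unit: "(\<Sum>x\<in>multi_index d (A \<union> B). (cmod (\<psi> x))\<^sup>2) = 1"
  shows "1 \<le> real (hdim d A) * purity d A B \<psi>"
proof -
  define N where "N = (\<lambda>a. \<Sum>b\<in>multi_index d B. (cmod (\<psi> (merge A B (a, b))))\<^sup>2)"
  have diag: "reduced_state d A B \<psi> a a = of_real (N a)" for a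
    unfolding reduced_state_def partial_trace_def ketbra_def N_def of_real_sum
    by (simp only: complex_norm_square)
  have "1 = (\<Sum>a\<in>multi_index d A. 1 * N a)\<^sup>2"
    using sum_merge[OF disj, where f = "\<lambda>x. (cmod (\<psi> x))\<^sup>2"] unit
    by (simp add: N_def)
  also have "\<dots> \<le> (\<Sum>a\<in>multi_index d A. 1\<^sup>2) * (\<Sum>a\<in>multi_index d A. (N a)\<^sup>2)"
    by (rule Cauchy_Schwarz_ineq_sum)
  also have "\<dots> = real (hdim d A) * (\<Sum>a\<in>multi_index d A. (N a)\<^sup>2)"
    by (simp add: card_multi_index fin)
  also have "(\<Sum>a\<in>multi_index d A. (N a)\<^sup>2) \<le> purity d A B \<psi>"
    unfolding purity_eq_sum
  proof (rule sum_mono)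
    fix a assume a: "a \<in> multi_index d A"
    have "(N a)\<^sup>2 = (cmod (reduced_state d A B \<psi> a a))\<^sup>2" by (simp add: diag)
    also have "\<dots> \<le> (\<Sum>a'\<in>multi_index d A. (cmod (reduced_state d A B \<psi> a a'))\<^sup>2)"
      by (rule member_le_sum) (use a fin finite_multi_index in auto)
    finally show "(N a)\<^sup>2 \<le> \<dots>" .
  qed
  finally show ?thesis by (simp add: mult_left_mono)
qed

text \<open>Keeps the denominator \<open>D - 1\<close> of the regularising factor positive.\<close>

lemma hdim_ge_2:
  assumes "finite A" "A \<noteq> {}" "\<And>i. i \<in> A \<Longrightarrow> d i \<ge> 2"
  shows "hdim d A \<ge> 2"
proof -
  obtain i where i: "i \<in> A" using assms(2) by blast
  have "(\<Prod>j\<in>A - {i}. 1) \<le> (\<Prod>j\<in>A - {i}. d j)"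
    by (rule prod_mono) (use assms(3) in fastforce)
  then have "2 * 1 \<le> d i * (\<Prod>j\<in>A - {i}. d j)"
    using assms(3)[OF i] by (intro mult_mono) auto
  then show ?thesis by (simp add: hdim_def prod.remove[OF assms(1) i])
qed

lemma concurrence_AB_eq:
  "concurrence_AB d A B \<psi> =
     (let D = real (min (hdim d A) (hdim d B)) in sqrt (D / (D - 1) * (1 - purity d A B \<psi>)))"
  by (simp add: concurrence_AB_def purity_def Let_def)

section \<open>Pure states\<close>

lemma concurrence_bounds:
  assumes d: "\<And>i. i \<in> {1..n} \<Longrightarrow> d i \<ge> 2" and \<psi>: "pure_state n d \<psi>"
    and P: "P \<in> bipartitions n"
  shows "0 \<le> concurrence n d P \<psi>" "concurrence n d P \<psi> \<le> 1"
proof -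
  obtain A B where AB: "P = {A, B}" "{A, B} \<in> bipartitions n"
    using P by (rule bipartitionsE)
  then have h: "A \<noteq> {}" "B \<noteq> {}" "A \<inter> B = {}" "A \<union> B = {1..n}"
    by (auto simp: doubleton_in_bipartitions_iff)
  then have fin: "finite A" "finite B"
    by (metis finite_Un finite_atLeastAtMost)+
  have unit: "(\<Sum>x\<in>multi_index d (A \<union> B). (cmod (\<psi> x))\<^sup>2) = 1"
    using \<psi> by (simp add: h pure_state_def)
  have dA: "hdim d A \<ge> 2" and dB: "hdim d B \<ge> 2"
    using hdim_ge_2[OF fin(1) h(1), of d] hdim_ge_2[OF fin(2) h(2), of d] d h(4) by blast+
  define D where "D = real (min (hdim d A) (hdim d B))"
  have D: "D \<ge> 2" using dA dB by (simp add: D_def)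
  \<comment> \<open>Equal purity of the two reductions gives the lower bound with either dimension,
    in particular with the smaller one, where it is strongest.\<close>
  have sym: "purity d B A \<psi> = purity d A B \<psi>"
    unfolding purity_def purity_commute[OF h(3)] ..
  have "1 \<le> real (hdim d A) * purity d A B \<psi>" "1 \<le> real (hdim d B) * purity d A B \<psi>"
    using purity_ge[OF fin(1) h(3) unit] purity_ge[of B A \<psi> d] fin h unit sym
    by (auto simp: Int_commute Un_commute)
  then have lower: "1 \<le> D * purity d A B \<psi>"
    by (simp add: D_def min_def)
  have upper: "purity d A B \<psi> \<le> 1" by (rule purity_le_1[OF h(3) unit])
  have c: "concurrence n d P \<psi> = sqrt (D / (D - 1) * (1 - purity d A B \<psi>))"
    by (simp add: AB concurrence_doubleton concurrence_AB_eq D_def Let_def)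
  show "0 \<le> concurrence n d P \<psi>" using D upper by (simp add: c)
  \<comment> \<open>After multiplication by \<open>D - 1\<close> this is exactly
    \<open>lower\<close>.\<close>
  have "D / (D - 1) * (1 - purity d A B \<psi>) \<le> 1"
    using D lower by (simp add: field_simps)
  then show "concurrence n d P \<psi> \<le> 1" by (simp add: c)
qed

lemma gbc_pure_nonneg: "0 \<le> gbc_pure n d \<psi>"
  by (simp add: gbc_pure_def)

lemma gbc_pure_le_1:
  assumes "\<And>i. i \<in> {1..n} \<Longrightarrow> d i \<ge> 2" "pure_state n d \<psi>"
  shows "gbc_pure n d \<psi> \<le> 1"
proof -
  have "0 \<le> (\<Prod>P\<in>bipartitions n. concurrence n d P \<psi>)"
    "(\<Prod>P\<in>bipartitions n. concurrence n d P \<psi>) \<le> 1"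
    using concurrence_bounds[OF assms] by (auto intro!: prod_nonneg prod_le_1)
  then show ?thesis
    unfolding gbc_pure_def by (intro powr_le1) auto
qed

text \<open>A maximally mixed state in dimension \<open>D\<close> has purity \<open>1 / D\<close>,
  and the factor \<open>D / (D - 1)\<close> is the inverse of \<open>1 - 1 / D\<close>.\<close>

lemma concurrence_ame:
  assumes d: "\<And>i. i \<in> {1..n} \<Longrightarrow> d i \<ge> 2" and \<psi>: "ame_state n d \<psi>"
    and P: "P \<in> bipartitions n"
  shows "concurrence n d P \<psi> = 1"
proof -
  \<comment> \<open>The bipartition is unordered, so \<open>A\<close> can be taken to be a block of
    smaller dimension, as \<open>ame_state\<close> asks.\<close>
  obtain A B where AB: "P = {A, B}" "{A, B} \<in> bipartitions n" "hdim d A \<le> hdim d B"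
    using P by (metis bipartitionsE insert_commute nle_le)
  then have h: "A \<noteq> {}" "A \<union> B = {1..n}"
    by (auto simp: doubleton_in_bipartitions_iff)
  then have fin: "finite A" by (metis finite_Un finite_atLeastAtMost)
  have D: "hdim d A \<ge> 2"
    using hdim_ge_2[OF fin h(1), of d] d h(2) by blast
  have \<rho>: "reduced_state d A B \<psi> a a' = (if a = a' then 1 / of_nat (hdim d A) else 0)"
    if "a \<in> multi_index d A" "a' \<in> multi_index d A" for a a'
    using \<psi> AB that by (auto simp: ame_state_def)
  have "purity d A B \<psi>
      = (\<Sum>a\<in>multi_index d A. \<Sum>a'\<in>multi_index d A. if a = a' then (1 / real (hdim d A))\<^sup>2 else 0)"
    unfolding purity_eq_sum
    by (intro sum.cong refl) (simp add: \<rho> norm_divide power_divide)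
  also have "\<dots> = real (hdim d A) * (1 / real (hdim d A))\<^sup>2"
    by (simp add: finite_multi_index fin card_multi_index)
  also have "\<dots> = 1 / real (hdim d A)"
    by (simp add: power2_eq_square)
  finally have "purity d A B \<psi> = 1 / real (hdim d A)" .
  then show ?thesis
    using D AB by (simp add: concurrence_doubleton concurrence_AB_eq Let_def min_def field_simps)
qed

lemma gbc_pure_ame:
  assumes "\<And>i. i \<in> {1..n} \<Longrightarrow> d i \<ge> 2" "ame_state n d \<psi>"
  shows "gbc_pure n d \<psi> = 1"
proof -
  have "(\<Prod>P\<in>bipartitions n. concurrence n d P \<psi>) = 1"
    using concurrence_ame[OF assms] by (intro prod.neutral ballI)
  then show ?thesis by (simp add: gbc_pure_def)
qed

text \<open>Reduced states see a vector only through its projector at the labels of the system. This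
  makes the GBC invariant under a global phase and independent of values at other labels.\<close>

lemma gbc_pure_cong_ketbra:
  assumes "\<And>x y. x \<in> multi_index d {1..n} \<Longrightarrow> y \<in> multi_index d {1..n} \<Longrightarrow>
             ketbra \<phi> x y = ketbra \<psi> x y"
  shows "gbc_pure n d \<phi> = gbc_pure n d \<psi>"
proof -
  have "concurrence n d P \<phi> = concurrence n d P \<psi>" if P: "P \<in> bipartitions n" for P
  proof -
    obtain A B where AB: "P = {A, B}" "{A, B} \<in> bipartitions n"
      using P by (rule bipartitionsE)
    then have h: "A \<inter> B = {}" "A \<union> B = {1..n}"
      by (auto simp: doubleton_in_bipartitions_iff)
    have "reduced_state d A B \<phi> a a' = reduced_state d A B \<psi> a a'"
      if "a \<in> multi_index d A" "a' \<in> multi_index d A" for a a'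
      unfolding reduced_state_def partial_trace_def
      by (intro sum.cong refl assms) (use that merge_in_multi_index[OF h(1)] h(2) in auto)
    then have "purity d A B \<phi> = purity d A B \<psi>"
      unfolding purity_eq_sum by (intro sum.cong refl) simp
    then show ?thesis by (simp add: AB concurrence_doubleton concurrence_AB_eq)
  qed
  then show ?thesis by (simp add: gbc_pure_def)
qed

section \<open>Ensembles\<close>

text \<open>Supplies a filler for ensemble members of weight 0, which must be unit vectors too. The
  witness is the basis vector at the all-zero label.\<close>

lemma pure_state_exists:
  assumes "\<And>i. i \<in> {1..n} \<Longrightarrow> d i \<ge> 2"
  obtains \<psi> where "pure_state n d \<psi>"
proof -
  define z where "z = (\<lambda>i\<in>{1..n}. 0 :: nat)"
  have z: "z \<in> multi_index d {1..n}"
    using assms by (force simp: z_def multi_index_def PiE_iff)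
  have "pure_state n d (\<lambda>x. if x = z then 1 else 0)"
    using z by (simp add: pure_state_def finite_multi_index if_distrib[of cmod]
        if_distrib[of "\<lambda>t. t\<^sup>2"] cong: if_cong)
  then show thesis by (rule that)
qed

text \<open>The squared norms of the vectors in a rank-one decomposition become the weights, and the
  normalised vectors become the states.\<close>

lemma ensemble_exists:
  assumes d: "\<And>i. i \<in> {1..n} \<Longrightarrow> d i \<ge> 2" and \<rho>: "density_operator n d \<rho>"
  obtains m p \<Psi> where "ensemble_of n d \<rho> m p \<Psi>"
proof -
  let ?X = "multi_index d {1..n}"
  obtain \<phi> where \<phi>: "pure_state n d \<phi>" using pure_state_exists[OF d] .
  have psd: "psd_on ?X \<rho>"
    using \<rho> unfolding psd_on_def density_operator_def by blast
  obtain m :: nat and v where mv: "\<And>x y. x \<in> ?X \<Longrightarrow> y \<in> ?X \<Longrightarrow>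
      \<rho> x y = (\<Sum>i<m. v i x * cnj (v i y))"
    by (rule psd_on_rank_one_decomposition[OF finite_multi_index[OF finite_atLeastAtMost] psd])
      (rule that)
  define p where "p = (\<lambda>i. \<Sum>x\<in>?X. (cmod (v i x))\<^sup>2)"
  define \<Psi> where "\<Psi> = (\<lambda>i. if p i = 0 then \<phi> else (\<lambda>x. v i x / of_real (sqrt (p i))))"
  have p: "p i \<ge> 0" for i by (simp add: p_def sum_nonneg)
  have pure: "pure_state n d (\<Psi> i)" for i
  proof (cases "p i = 0")
    case True
    then show ?thesis by (simp add: \<Psi>_def \<phi>)
  next
    case False
    then have "(\<Sum>x\<in>?X. (cmod (\<Psi> i x))\<^sup>2) = (\<Sum>x\<in>?X. (cmod (v i x))\<^sup>2 / p i)"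
      using p[of i] by (intro sum.cong) (auto simp: \<Psi>_def norm_divide power_divide)
    also have "\<dots> = 1" using False by (simp add: p_def flip: sum_divide_distrib)
    finally show ?thesis by (simp add: pure_state_def)
  qed
  have weighted: "of_real (p i) * ketbra (\<Psi> i) x y = v i x * cnj (v i y)"
    if "x \<in> ?X" "y \<in> ?X" for i x y
  proof (cases "p i = 0")
    \<comment> \<open>Weight 0 means that \<open>v i\<close> vanishes at every label, so the filler
      \<open>\<phi>\<close> does not change the sum.\<close>
    case True
    then have "v i x = 0"
      using that finite_multi_index[of "{1..n}" d] by (auto simp: p_def sum_nonneg_eq_0_iff)
    then show ?thesis using True by simp
  next
    case False
    have "complex_of_real (sqrt (p i)) * of_real (sqrt (p i)) = of_real (p i)"
      using p[of i] by (simp flip: of_real_mult)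
    then show ?thesis using False by (simp add: \<Psi>_def ketbra_def)
  qed
  \<comment> \<open>The total weight is the trace of \<open>\<rho>\<close>.\<close>
  have "complex_of_real (\<Sum>i<m. p i) = (\<Sum>i<m. \<Sum>x\<in>?X. v i x * cnj (v i x))"
    by (simp only: p_def of_real_sum complex_norm_square)
  also have "\<dots> = (\<Sum>x\<in>?X. \<rho> x x)"
    by (subst sum.swap) (simp add: mv)
  also have "\<dots> = 1" using \<rho> unfolding density_operator_def op_trace_def by blast
  finally have sum_p: "(\<Sum>i<m. p i) = 1" by (simp only: of_real_eq_1_iff)
  have "ensemble_of n d \<rho> m p \<Psi>"
    unfolding ensemble_of_def
  proof (intro conjI ballI allI impI)
    show "\<rho> x y = (\<Sum>i<m. complex_of_real (p i) * ketbra (\<Psi> i) x y)"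
      if "x \<in> ?X" "y \<in> ?X" for x y
      unfolding mv[OF that] weighted[OF that] ..
  qed (rule p pure sum_p)+
  then show thesis by (rule that)
qed

section \<open>Ensembles of a rank-one projector\<close>

lemma ensemble_of_ketbra:
  "pure_state n d \<psi> \<Longrightarrow> ensemble_of n d (ketbra \<psi>) 1 (\<lambda>_. 1) (\<lambda>_. \<psi>)"
  by (simp add: ensemble_of_def)

text \<open>The deficits \<open>p i * (1 - f i)\<close> are nonnegative and sum to 0, so each of
  them vanishes.\<close>

lemma convex_combination_extreme:
  fixes p f :: "nat \<Rightarrow> real"
  assumes "\<And>i. i < m \<Longrightarrow> 0 \<le> p i" "\<And>i. i < m \<Longrightarrow> f i \<le> 1"
    and "(\<Sum>i<m. p i) = 1" "(\<Sum>i<m. p i * f i) = 1" "i < m" "p i \<noteq> 0"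
  shows "f i = 1"
proof -
  have "(\<Sum>i<m. p i * (1 - f i)) = 0"
    using assms by (simp add: right_diff_distrib sum_subtractf)
  then have "\<forall>i\<in>{..<m}. p i * (1 - f i) = 0"
    by (subst (asm) sum_nonneg_eq_0_iff) (use assms in auto)
  with assms show ?thesis by auto
qed

text \<open>The equality case of Cauchy-Schwarz: the squared norm of
  \<open>\<phi> - c * \<psi>\<close> expands to 1 minus the squared modulus of \<open>c\<close>,
  which is 0.\<close>

lemma unit_overlap_imp_phase:
  assumes X: "finite X"
    and \<psi>: "(\<Sum>x\<in>X. (cmod (\<psi> x))\<^sup>2) = 1" and \<phi>: "(\<Sum>x\<in>X. (cmod (\<phi> x))\<^sup>2) = 1"
    and c: "c = (\<Sum>x\<in>X. \<phi> x * cnj (\<psi> x))" "cmod c = 1" and x: "x \<in> X"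
  shows "\<phi> x = c * \<psi> x"
proof -
  have expand: "complex_of_real ((cmod (\<phi> x - c * \<psi> x))\<^sup>2)
      = \<phi> x * cnj (\<phi> x) - cnj c * (\<phi> x * cnj (\<psi> x)) - c * cnj (\<phi> x * cnj (\<psi> x))
        + c * cnj c * (\<psi> x * cnj (\<psi> x))" for x
    unfolding complex_norm_square by (simp add: algebra_simps)
  have cc: "c * cnj c = 1" using c(2) by (simp flip: complex_norm_square)
  have norms: "(\<Sum>x\<in>X. \<phi> x * cnj (\<phi> x)) = 1" "(\<Sum>x\<in>X. \<psi> x * cnj (\<psi> x)) = 1"
    using \<psi> \<phi> by (metis (mono_tags, lifting) complex_norm_square of_real_1 of_real_sum sum.cong)+
  have "complex_of_real (\<Sum>x\<in>X. (cmod (\<phi> x - c * \<psi> x))\<^sup>2)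
      = (\<Sum>x\<in>X. \<phi> x * cnj (\<phi> x)) - cnj c * c - c * cnj c
        + c * cnj c * (\<Sum>x\<in>X. \<psi> x * cnj (\<psi> x))"
    unfolding of_real_sum expand
    by (simp only: c(1) sum.distrib sum_subtractf sum_distrib_left cnj_sum)
  also have "\<dots> = 0" using cc norms by (simp add: mult.commute)
  finally have "(\<Sum>x\<in>X. (cmod (\<phi> x - c * \<psi> x))\<^sup>2) = 0"
    by (simp only: of_real_eq_0_iff)
  then have "(cmod (\<phi> x - c * \<psi> x))\<^sup>2 = 0"
    using X x by (subst (asm) sum_nonneg_eq_0_iff) auto
  then show ?thesis by simp
qed

text \<open>The expectation of the projector in \<open>\<psi>\<close> is 1, and it is also the
  weighted mean of the squared overlaps of \<open>\<psi>\<close> with the members. Each of these is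
  at most 1, so every overlap of nonzero weight has modulus 1 and forces equality up to a
  phase.\<close>

lemma ensemble_of_ketbra_unique:
  assumes \<psi>: "pure_state n d \<psi>" and ens: "ensemble_of n d (ketbra \<psi>) m p \<Psi>"
    and i: "i < m" "p i \<noteq> 0"
    and xy: "x \<in> multi_index d {1..n}" "y \<in> multi_index d {1..n}"
  shows "ketbra (\<Psi> i) x y = ketbra \<psi> x y"
proof -
  let ?X = "multi_index d {1..n}"
  define c where "c = (\<lambda>i. \<Sum>x\<in>?X. \<Psi> i x * cnj (\<psi> x))"
  have fin: "finite ?X" by (simp add: finite_multi_index)
  have p: "0 \<le> p i" and unit: "(\<Sum>x\<in>?X. (cmod (\<Psi> i x))\<^sup>2) = 1" if "i < m" for i
    using ens that by (auto simp: ensemble_of_def pure_state_def)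
  have sum_p: "(\<Sum>i<m. p i) = 1" using ens by (simp add: ensemble_of_def)
  have unit_\<psi>: "(\<Sum>x\<in>?X. (cmod (\<psi> x))\<^sup>2) = 1" using \<psi> by (simp add: pure_state_def)
  have form: "(\<Sum>x\<in>?X. \<Sum>y\<in>?X. cnj (\<psi> x) * ketbra \<phi> x y * \<psi> y)
      = of_real ((cmod (\<Sum>x\<in>?X. \<phi> x * cnj (\<psi> x)))\<^sup>2)" for \<phi>
    unfolding complex_norm_square cnj_sum sum_product ketbra_def
    by (simp add: mult_ac)
  have "(\<Sum>x\<in>?X. \<psi> x * cnj (\<psi> x)) = complex_of_real (\<Sum>x\<in>?X. (cmod (\<psi> x))\<^sup>2)"
    by (simp only: of_real_sum complex_norm_square)
  then have "1 = (\<Sum>x\<in>?X. \<Sum>y\<in>?X. cnj (\<psi> x) * ketbra \<psi> x y * \<psi> y)"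
    using unit_\<psi> by (simp only: form) simp
  also have "\<dots> = (\<Sum>x\<in>?X. \<Sum>y\<in>?X. \<Sum>i<m.
      of_real (p i) * (cnj (\<psi> x) * ketbra (\<Psi> i) x y * \<psi> y))"
    using ens by (intro sum.cong refl)
      (simp add: ensemble_of_def sum_distrib_left sum_distrib_right mult_ac)
  also have "\<dots> = (\<Sum>x\<in>?X. \<Sum>i<m. \<Sum>y\<in>?X.
      of_real (p i) * (cnj (\<psi> x) * ketbra (\<Psi> i) x y * \<psi> y))"
    by (intro sum.cong refl sum.swap)
  also have "\<dots> = (\<Sum>i<m. \<Sum>x\<in>?X. \<Sum>y\<in>?X.
      of_real (p i) * (cnj (\<psi> x) * ketbra (\<Psi> i) x y * \<psi> y))"
    by (rule sum.swap)
  also have "\<dots> = complex_of_real (\<Sum>i<m. p i * (cmod (c i))\<^sup>2)"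
    by (simp only: of_real_sum of_real_mult c_def form[symmetric] sum_distrib_left)
  finally have "(\<Sum>i<m. p i * (cmod (c i))\<^sup>2) = 1"
    by (metis of_real_eq_1_iff)
  moreover have "(cmod (c i))\<^sup>2 \<le> 1" if "i < m" for i
    using cmod_sum_mult_cnj_le[of "\<Psi> i" \<psi> ?X] unit[OF that] unit_\<psi> by (simp add: c_def)
  ultimately have "(cmod (c i))\<^sup>2 = 1"
    using convex_combination_extreme[where p = p and f = "\<lambda>i. (cmod (c i))\<^sup>2"] p sum_p i by blast
  then have ci: "cmod (c i) = 1"
    using norm_ge_zero[of "c i"] unfolding power2_eq_1_iff by linarith
  have \<Psi>: "\<Psi> i x = c i * \<psi> x" if "x \<in> ?X" for x
    using unit_overlap_imp_phase[OF fin unit_\<psi> unit[OF i(1)] _ ci that] by (simp add: c_def)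
  \<comment> \<open>The phase cancels in the projector.\<close>
  have "c i * cnj (c i) = 1" using ci by (simp flip: complex_norm_square)
  then have "c i * \<psi> x * cnj (c i * \<psi> y) = \<psi> x * cnj (\<psi> y)"
    by (simp add: mult_ac)
  then show ?thesis by (simp only: ketbra_def \<Psi> xy)
qed

section \<open>The convex roof\<close>

lemma gbc_le_1:
  assumes d: "\<And>i. i \<in> {1..n} \<Longrightarrow> d i \<ge> 2" and \<rho>: "density_operator n d \<rho>"
  shows "gbc n d \<rho> \<le> 1"
proof -
  obtain m p \<Psi> where ens: "ensemble_of n d \<rho> m p \<Psi>" using ensemble_exists[OF d \<rho>] .
  have "gbc n d \<rho> \<le> (\<Sum>i<m. p i * gbc_pure n d (\<Psi> i))"
    unfolding gbc_def
  proof (rule cInf_lower)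
    \<comment> \<open>The infimum lies below a given average only because the averages are bounded
      below.\<close>
    show "bdd_below {(\<Sum>i<m. p i * gbc_pure n d (\<Psi> i)) | m p \<Psi>. ensemble_of n d \<rho> m p \<Psi>}"
      by (intro bdd_belowI[where m = 0])
        (auto simp: ensemble_of_def intro!: sum_nonneg mult_nonneg_nonneg gbc_pure_nonneg)
  qed (use ens in blast)
  also have "\<dots> \<le> (\<Sum>i<m. p i * 1)"
    using ens gbc_pure_le_1[OF d]
    by (intro sum_mono mult_left_mono) (auto simp: ensemble_of_def)
  also have "\<dots> = 1" using ens by (simp add: ensemble_of_def)
  finally show ?thesis .
qed

text \<open>All ensembles of a projector have the same average, so the infimum runs over a single
  value. The convex roof thus extends the GBC of pure states.\<close>

lemma gbc_ketbra:
  assumes \<psi>: "pure_state n d \<psi>"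
  shows "gbc n d (ketbra \<psi>) = gbc_pure n d \<psi>"
proof -
  have avg: "(\<Sum>i<m. p i * gbc_pure n d (\<Psi> i)) = gbc_pure n d \<psi>"
    if ens: "ensemble_of n d (ketbra \<psi>) m p \<Psi>" for m p \<Psi>
  proof -
    have "(\<Sum>i<m. p i * gbc_pure n d (\<Psi> i)) = (\<Sum>i<m. p i * gbc_pure n d \<psi>)"
    proof (rule sum.cong[OF refl])
      fix i assume "i \<in> {..<m}"
      \<comment> \<open>A member of weight 0 may be any unit vector, but it contributes
        nothing.\<close>
      then show "p i * gbc_pure n d (\<Psi> i) = p i * gbc_pure n d \<psi>"
        using gbc_pure_cong_ketbra[OF ensemble_of_ketbra_unique[OF \<psi> ens]]
        by (cases "p i = 0") auto
    qed
    also have "\<dots> = gbc_pure n d \<psi>"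
      using ens by (simp add: ensemble_of_def flip: sum_distrib_right)
    finally show ?thesis .
  qed
  have "{(\<Sum>i<m. p i * gbc_pure n d (\<Psi> i)) | m p \<Psi>. ensemble_of n d (ketbra \<psi>) m p \<Psi>}
      = {gbc_pure n d \<psi>}"
  proof (intro equalityI subsetI)
    fix r assume "r \<in> {gbc_pure n d \<psi>}"
    then have "r = gbc_pure n d \<psi>" by simp
    \<comment> \<open>The value is attained by the ensemble whose only member is
      \<open>\<psi>\<close>, with weight 1.\<close>
    also have "\<dots> = (\<Sum>i<1::nat. (\<lambda>_. 1) i * gbc_pure n d ((\<lambda>_. \<psi>) i))" by simp
    finally show "r \<in> {(\<Sum>i<m. p i * gbc_pure n d (\<Psi> i)) | m p \<Psi>.
        ensemble_of n d (ketbra \<psi>) m p \<Psi>}"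
      using ensemble_of_ketbra[OF \<psi>] by (intro CollectI exI conjI)
  qed (auto simp: avg)
  then show ?thesis by (simp add: gbc_def)
qed

text \<open>On a pure state the GBC can be read as the product formula or as the convex roof at its
  projector. Both readings are covered, and \<open>gbc_ketbra\<close> identifies them.\<close>

theorem mainTheorem2:
  fixes n :: nat and d :: "nat \<Rightarrow> nat"
  assumes "n \<ge> 2"
    and "\<And>i. i \<in> {1..n} \<Longrightarrow> d i \<ge> 2"
  shows "(\<forall>\<rho>. density_operator n d \<rho> \<longrightarrow> gbc n d \<rho> \<le> 1) \<and>
         (\<forall>\<psi>. pure_state n d \<psi> \<longrightarrow> gbc_pure n d \<psi> \<le> 1) \<and>
         (\<forall>\<psi>. ame_state n d \<psi> \<longrightarrow> gbc_pure n d \<psi> = 1 \<and> gbc n d (ketbra \<psi>) = 1)"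
proof (intro conjI allI impI)
  show "gbc n d \<rho> \<le> 1" if "density_operator n d \<rho>" for \<rho>
    using gbc_le_1[OF assms(2) that] .
  show "gbc_pure n d \<psi> \<le> 1" if "pure_state n d \<psi>" for \<psi>
    using gbc_pure_le_1[OF assms(2) that] .
  fix \<psi> assume ame: "ame_state n d \<psi>"
  show "gbc_pure n d \<psi> = 1" using gbc_pure_ame[OF assms(2) ame] .
  then show "gbc n d (ketbra \<psi>) = 1"
    using gbc_ketbra[of n d \<psi>] ame by (simp add: ame_state_def)
qed

end
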